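(* Let $\lambda\le\kappa$ be regular infinite cardinals and let $r:[\kappa^+]^2\to\lambda$ be a transitive function. Then the family $\mathcal F_r=\{F^r_\xi(\beta):\xi<\lambda,\ \beta<\kappa^+\}$, where $F^r_\xi(\beta)=\{\alpha<\beta: r(\alpha,\beta)\le\xi\}$, is a $(\kappa,\lambda)$-matrix (indexed by $\kappa^+$).
   Context: Ordinals are identified with the set of smaller ordinals. A function $r:[\kappa^+]^2\to\lambda$ (written $r(\alpha,\beta)$ for $\alpha<\beta$) is transitive if $r(\alpha,\gamma)\le\max\{r(\alpha,\beta),r(\beta,\gamma)\}$ for all $\alpha<\beta<\gamma<\kappa^+$. A $(\kappa,\lambda)$-matrix indexed by $\kappa^+$ is a family $\mathcal F=\{F_\xi(\alpha):\alpha<\kappa^+,\ \xi<\lambda\}$ of sets such that: (G1) $\bigcup_{\xi<\lambda}F_\xi(\alpha)=\alpha$ for every $\alpha<\kappa^+$; (G2) $F_\xi(\alpha)\subseteq F_\eta(\alpha)$ for each $\alpha<\kappa^+$ and all $\xi\le\eta<\lambda$; (G3) for all $\alpha\le\beta<\kappa^+$ and each $\xi<\lambda$ there is $\eta<\lambda$ with $F_\xi(\alpha)\subseteq F_\eta(\beta)$. *)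

theory Defs
  imports Main
begin

unbundle cardinal_syntax

text \<open>
  Infinite cardinals are well-orders satisfying the predicate \<^const>\<open>Card_order\<close>. The ordinals below
  such a cardinal \<open>R\<close> are the elements of \<open>Field R\<close>, and an ordinal \<open>\<beta>\<close>, as the set of its
  predecessors, is \<open>underS R \<beta>\<close>. The successor cardinal of \<open>\<kappa>\<close> is \<open>cardSuc \<kappa>\<close>.
\<close>

definition regular_infinite_cardinal :: "'a rel \<Rightarrow> bool" where
  "regular_infinite_cardinal R \<longleftrightarrow> Cinfinite R \<and> regularCard R"

text \<open>A function on increasing pairs is curried; its values at other pairs are irrelevant.\<close>

definition pair_function :: "'a rel \<Rightarrow> 'b rel \<Rightarrow> ('a \<Rightarrow> 'a \<Rightarrow> 'b) \<Rightarrow> bool" where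
  "pair_function K L r \<longleftrightarrow> (\<forall>\<beta>\<in>Field K. \<forall>\<alpha>\<in>underS K \<beta>. r \<alpha> \<beta> \<in> Field L)"

definition transitive_function :: "'a rel \<Rightarrow> 'b rel \<Rightarrow> ('a \<Rightarrow> 'a \<Rightarrow> 'b) \<Rightarrow> bool" where
  "transitive_function K L r \<longleftrightarrow>
     (\<forall>\<gamma>\<in>Field K. \<forall>\<beta>\<in>underS K \<gamma>. \<forall>\<alpha>\<in>underS K \<beta>.
        (r \<alpha> \<gamma>, wo_rel.max2 L (r \<alpha> \<beta>) (r \<beta> \<gamma>)) \<in> L)"

definition cardinal_matrix :: "'a rel \<Rightarrow> 'b rel \<Rightarrow> ('b \<Rightarrow> 'a set \<Rightarrow> 'a set set) \<Rightarrow> bool" where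
  "cardinal_matrix \<kappa> L F \<longleftrightarrow>
     (\<forall>\<alpha>\<in>Field (cardSuc \<kappa>). (\<Union>\<xi>\<in>Field L. F \<xi> \<alpha>) = underS (cardSuc \<kappa>) \<alpha>) \<and>
     (\<forall>\<alpha>\<in>Field (cardSuc \<kappa>). \<forall>\<xi> \<eta>. (\<xi>, \<eta>) \<in> L \<longrightarrow> F \<xi> \<alpha> \<subseteq> F \<eta> \<alpha>) \<and>
     (\<forall>\<alpha> \<beta>. (\<alpha>, \<beta>) \<in> cardSuc \<kappa> \<longrightarrow> (\<forall>\<xi>\<in>Field L. \<exists>\<eta>\<in>Field L. F \<xi> \<alpha> \<subseteq> F \<eta> \<beta>))"

definition sublevel_family :: "'a rel \<Rightarrow> 'b rel \<Rightarrow> ('a \<Rightarrow> 'a \<Rightarrow> 'b) \<Rightarrow> 'b \<Rightarrow> 'a \<Rightarrow> 'a set" where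
  "sublevel_family K L r \<xi> \<beta> = {\<alpha> \<in> underS K \<beta>. (r \<alpha> \<beta>, \<xi>) \<in> L}"

end

theory Submission
  imports Defs
begin

text \<open>
  The only point of substance is (G3): for \<open>\<alpha> < \<beta>\<close>, transitivity of \<open>r\<close> bounds
  \<open>r \<gamma> \<beta>\<close> by the maximum of \<open>\<xi>\<close> and \<open>r \<alpha> \<beta>\<close> for every \<open>\<gamma>\<close> with
  \<open>r \<gamma> \<alpha> \<le> \<xi>\<close>, so this maximum serves as \<open>\<eta>\<close>.
\<close>

text \<open>Each \<alpha> below \<beta> enters at the level given by its own value
  \<open>r \<alpha> \<beta>\<close>, which is an admissible index by
  \<open>pair_function\<close>.\<close>

lemma UN_sublevel_family:
  assumes "Well_order L" and "pair_function K L r" and "\<beta> \<in> Field K"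
  shows "(\<Union>\<xi>\<in>Field L. sublevel_family K L r \<xi> \<beta>) = underS K \<beta>"
proof -
  have "\<alpha> \<in> sublevel_family K L r (r \<alpha> \<beta>) \<beta>" and "r \<alpha> \<beta> \<in> Field L" if "\<alpha> \<in> underS K \<beta>" for \<alpha>
    using assms that wo_rel.REFL[of L]
    by (auto simp: sublevel_family_def pair_function_def wo_rel_def refl_on_def)
  then show ?thesis
    by (auto simp: sublevel_family_def)
qed

lemma sublevel_family_mono:
  assumes "Well_order L" and "(\<xi>, \<eta>) \<in> L"
  shows "sublevel_family K L r \<xi> \<beta> \<subseteq> sublevel_family K L r \<eta> \<beta>"
  using assms wo_rel.TRANS[of L]
  by (auto simp: sublevel_family_def wo_rel_def dest: transD)

lemma sublevel_family_subset_max2: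
  assumes K: "Well_order K" and L: "Well_order L"
    and pair: "pair_function K L r" and trans: "transitive_function K L r"
    and \<beta>: "\<beta> \<in> Field K" and \<alpha>: "\<alpha> \<in> underS K \<beta>" and \<xi>: "\<xi> \<in> Field L"
  shows "sublevel_family K L r \<xi> \<alpha> \<subseteq> sublevel_family K L r (wo_rel.max2 L \<xi> (r \<alpha> \<beta>)) \<beta>"
proof
  fix \<gamma> assume "\<gamma> \<in> sublevel_family K L r \<xi> \<alpha>"
  then have \<gamma>: "\<gamma> \<in> underS K \<alpha>" and le: "(r \<gamma> \<alpha>, \<xi>) \<in> L"
    by (auto simp: sublevel_family_def)
  interpret L: wo_rel L
    using L by (simp add: wo_rel_def)
  \<comment> \<open>Antisymmetry gives strictness: \<gamma> = \<beta> would force \<alpha> =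
    \<beta>.\<close>
  have \<gamma>\<beta>: "\<gamma> \<in> underS K \<beta>"
    using K \<alpha> \<gamma> wo_rel.TRANS[of K] wo_rel.ANTISYM[of K]
    by (auto simp: underS_def wo_rel_def dest: transD antisymD)
  have "r \<alpha> \<beta> \<in> Field L"
    using pair \<alpha> \<beta> by (auto simp: pair_function_def)
  then have \<xi>_max: "(\<xi>, L.max2 \<xi> (r \<alpha> \<beta>)) \<in> L"
    and r_max: "(r \<alpha> \<beta>, L.max2 \<xi> (r \<alpha> \<beta>)) \<in> L"
    using \<xi> L.max2_greater by auto
  have "(r \<gamma> \<beta>, L.max2 (r \<gamma> \<alpha>) (r \<alpha> \<beta>)) \<in> L"
    using trans \<alpha> \<beta> \<gamma> by (auto simp: transitive_function_def)
  \<comment> \<open>The maximum is monotone in its first argument. Only the left \<open>max2\<close>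
    is unfolded: it equals one of its two arguments, and each of these is already bounded by the
    right one, \<open>r \<gamma> \<alpha>\<close> by way of \<xi>.\<close>
  moreover have "(L.max2 (r \<gamma> \<alpha>) (r \<alpha> \<beta>), L.max2 \<xi> (r \<alpha> \<beta>)) \<in> L"
    using r_max transD[OF L.TRANS le \<xi>_max] by (subst (1) L.max2_def) (metis (full_types))
  ultimately show "\<gamma> \<in> sublevel_family K L r (L.max2 \<xi> (r \<alpha> \<beta>)) \<beta>"
    using \<gamma>\<beta> transD[OF L.TRANS] by (auto simp: sublevel_family_def)
qed

theorem theorem5p1:
  fixes \<kappa> :: "'a rel" and L :: "'b rel" and r :: "'a set \<Rightarrow> 'a set \<Rightarrow> 'b"
  assumes "regular_infinite_cardinal \<kappa>" and "regular_infinite_cardinal L" and "L \<le>o \<kappa>"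
    and "pair_function (cardSuc \<kappa>) L r"
    and "transitive_function (cardSuc \<kappa>) L r"
  shows "cardinal_matrix \<kappa> L (sublevel_family (cardSuc \<kappa>) L r)"
proof -
  have K: "Well_order (cardSuc \<kappa>)" and L: "Well_order L"
    using assms(1,2) cardSuc_Card_order card_order_on_well_order_on
    by (auto simp: regular_infinite_cardinal_def cinfinite_def)
  have "\<exists>\<eta>\<in>Field L. sublevel_family (cardSuc \<kappa>) L r \<xi> \<alpha> \<subseteq> sublevel_family (cardSuc \<kappa>) L r \<eta> \<beta>"
    if "(\<alpha>, \<beta>) \<in> cardSuc \<kappa>" and \<xi>: "\<xi> \<in> Field L" for \<alpha> \<beta> \<xi>
  \<comment> \<open>The diagonal is treated apart because \<open>r\<close> is meaningful only on
    increasing pairs; there \<eta> = \<xi> works.\<close>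
  proof (cases "\<alpha> = \<beta>")
    case True
    then show ?thesis using \<xi> by blast
  next
    case False
    then have \<alpha>: "\<alpha> \<in> underS (cardSuc \<kappa>) \<beta>" and \<beta>: "\<beta> \<in> Field (cardSuc \<kappa>)"
      using that(1) by (auto simp: underS_def Field_def)
    \<comment> \<open>The witness is a legitimate index, being one of two elements of
      \<open>Field L\<close>.\<close>
    then have "wo_rel.max2 L \<xi> (r \<alpha> \<beta>) \<in> Field L"
      using assms(4) \<xi> L by (auto simp: pair_function_def wo_rel.max2_def wo_rel_def)
    then show ?thesis
      using sublevel_family_subset_max2[OF K L assms(4,5) \<beta> \<alpha> \<xi>] by blast
  qed
  then show ?thesis
    unfolding cardinal_matrix_def
    by (simp add: UN_sublevel_family[OF L assms(4)] sublevel_family_mono[OF L])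
qed

end
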